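(* Let $A$ and $B$ be alphabets and let $(S, X)$ be a Boolean space with an internal semigroup. Then, for every pair of morphisms of Boolean spaces with internal semigroups $$f: (B^+, \beta(B^+)) \to (A^+, \beta(A^+)), \qquad g: (B^+, \beta(B^+)) \to (S, X)$$ with $f$ length-preserving, the map $h = \mathcal V(g) \circ f^* \circ i : \beta(A^+) \to \mathcal V(X)$ is a morphism of Boolean spaces with internal semigroups $(A^+, \beta(A^+)) \to \mathcal V(S,X)$.
   Context: An alphabet is a finite set of letters; $A^+$ is the free semigroup of non-empty words over $A$. A Boolean space is a compact Hausdorff space with a basis of clopen sets. A Boolean space with an internal semigroup (BiS) is a pair $(S,X)$ where $S$ is a semigroup densely contained (as a subset) in a Boolean space $X$, such that for each $s \in S$ there are continuous maps $\lambda_s, \rho_s : X \to X$ extending respectively the left multiplication $t \mapsto st$ and the right multiplication $t \mapsto ts$ of $S$. A morphism of BiSs $(S,X) \to (T,Y)$ is a continuous map $X \to Y$ that restricts to a semigroup homomorphism $S \to T$. The pair $(A^+, \beta(A^+))$, with $\beta$ the Stone–Čech compactification of the discrete set $A^+$, is a BiS. A morphism $f: (B^+, \beta(B^+)) \to (A^+, \beta(A^+))$ is length-preserving if its restriction $B^+ \to A^+$ maps letters to letters. For a Boolean space $X$, $\mathcal V(X)$ is the Vietoris space: the set of all closed subsets of $X$ (including $\emptyset$) with the topology generated by the sets $\Diamond U = \{C \mid C \cap U \neq \emptyset\}$ and $\Box U = \{C \mid C \subseteq U\}$, $U \subseteq X$ open. For continuous maps $f: Z\to Y$ and $g: Z \to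 X$, $f^*: \mathcal V(Y) \to \mathcal V(Z)$ is $C \mapsto f^{-1}(C)$, $\mathcal V(g): \mathcal V(Z) \to \mathcal V(X)$ is $C \mapsto g[C]$, and $i: Y \to \mathcal V(Y)$ is $y \mapsto \{y\}$; thus $(\mathcal V(g)\circ f^*\circ i)(y) = g[f^{-1}(\{y\})]$. For a BiS $(S,X)$, the Vietoris of $(S,X)$ is the BiS $\mathcal V(S,X) = (\mathcal P_{fin}(S), \mathcal V(X))$, where $\mathcal P_{fin}(S)$ is the semigroup of all finite subsets of $S$ (including $\emptyset$) under pointwise multiplication $Q_1 \cdot Q_2 = \{s_1s_2 \mid s_1 \in Q_1, s_2 \in Q_2\}$, regarded as a subset of $\mathcal V(X)$, and with the actions $\lambda_Q(C) = \bigcup_{s \in Q}\lambda_s[C]$ and $\rho_Q(C) = \bigcup_{s\in Q}\rho_s[C]$ for $Q \in \mathcal P_{fin}(S)$, $C \in \mathcal V(X)$. *)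

theory Defs
  imports "HOL-Analysis.Analysis"
begin

section \<open>Boolean spaces with an internal semigroup\<close>

definition Boolean_space :: "'x topology \<Rightarrow> bool" where
  "Boolean_space X \<longleftrightarrow> compact_space X \<and> Hausdorff_space X \<and>
     (\<exists>\<B>. (\<forall>V\<in>\<B>. openin X V \<and> closedin X V) \<and>
          openin X = arbitrary union_of (\<lambda>V. V \<in> \<B>))"

text \<open>
  The containment of the semigroup in the space is an injection \<open>emb\<close>; the case of a literal subset is
  \<open>emb = id\<close>. The actions \<open>lact s\<close>, \<open>ract s\<close> are the continuous extensions \<open>\<lambda>\<^sub>s\<close>, \<open>\<rho>\<^sub>s\<close> of the
  multiplications by \<open>s\<close>. Since the semigroup is dense and the space Hausdorff, they are determined
  on the space by the other components, so recording them is the same as requiring that they exist.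
\<close>

record ('s, 'x) bis_struct =
  elts :: "'s set"
  mul  :: "'s \<Rightarrow> 's \<Rightarrow> 's"
  spc  :: "'x topology"
  emb  :: "'s \<Rightarrow> 'x"
  lact :: "'s \<Rightarrow> 'x \<Rightarrow> 'x"
  ract :: "'s \<Rightarrow> 'x \<Rightarrow> 'x"

locale bis =
  fixes M :: "('s, 'x) bis_struct"
  assumes mul_closed: "\<lbrakk>s \<in> elts M; t \<in> elts M\<rbrakk> \<Longrightarrow> mul M s t \<in> elts M"
    and mul_assoc: "\<lbrakk>r \<in> elts M; s \<in> elts M; t \<in> elts M\<rbrakk>
          \<Longrightarrow> mul M (mul M r s) t = mul M r (mul M s t)"
    and Boolean: "Boolean_space (spc M)"
    and emb_closed: "s \<in> elts M \<Longrightarrow> emb M s \<in> topspace (spc M)"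
    and emb_inj: "inj_on (emb M) (elts M)"
    and emb_dense: "spc M closure_of (emb M ` elts M) = topspace (spc M)"
    and lact_continuous: "s \<in> elts M \<Longrightarrow> continuous_map (spc M) (spc M) (lact M s)"
    and lact_extends: "\<lbrakk>s \<in> elts M; t \<in> elts M\<rbrakk> \<Longrightarrow> lact M s (emb M t) = emb M (mul M s t)"
    and ract_continuous: "s \<in> elts M \<Longrightarrow> continuous_map (spc M) (spc M) (ract M s)"
    and ract_extends: "\<lbrakk>s \<in> elts M; t \<in> elts M\<rbrakk> \<Longrightarrow> ract M s (emb M t) = emb M (mul M t s)"

locale bis_morphism = dom: bis M + cod: bis N
  for M :: "('s, 'x) bis_struct" and N :: "('t, 'y) bis_struct" +
  fixes \<phi> :: "'x \<Rightarrow> 'y"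
  assumes continuous: "continuous_map (spc M) (spc N) \<phi>"
    and restricts_to_hom:
      "\<exists>\<eta>. (\<forall>s\<in>elts M. \<eta> s \<in> elts N \<and> \<phi> (emb M s) = emb N (\<eta> s)) \<and>
           (\<forall>s\<in>elts M. \<forall>t\<in>elts M. \<eta> (mul M s t) = mul N (\<eta> s) (\<eta> t))"

section \<open>The free semigroup inside its Stone-Cech compactification\<close>

text \<open>
  The Stone-Cech compactification of a discrete set \<open>D\<close>, as the space of ultrafilters on \<open>D\<close>; a point
  of \<open>D\<close> is identified with its principal ultrafilter. An ultrafilter on \<open>D\<close> is represented by the
  filter on the whole type that it generates.
\<close>

definition ultrafilters_on :: "'d set \<Rightarrow> 'd filter set" where
  "ultrafilters_on D = {u. u \<noteq> bot \<and> eventually (\<lambda>x. x \<in> D) u \<and>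
     (\<forall>P. eventually P u \<or> eventually (\<lambda>x. \<not> P x) u)}"

definition stone_cech :: "'d set \<Rightarrow> 'd filter topology" where
  "stone_cech D = topology_generated_by
     {{u \<in> ultrafilters_on D. eventually (\<lambda>x. x \<in> P) u} | P. P \<subseteq> D}"

lemma topspace_stone_cech: "topspace (stone_cech D) = ultrafilters_on D"
proof -
  have "{u \<in> ultrafilters_on D. eventually (\<lambda>x. x \<in> D) u} = ultrafilters_on D"
    by (auto simp: ultrafilters_on_def)
  then have "ultrafilters_on D \<in> {{u \<in> ultrafilters_on D. eventually (\<lambda>x. x \<in> P) u} | P. P \<subseteq> D}"
    by blast
  then show ?thesis
    unfolding stone_cech_def topology_generated_by_topspace by blast
qed

definition words :: "'a set \<Rightarrow> 'a list set" where
  "words A = lists A - {[]}"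

definition beta_words :: "'a set \<Rightarrow> ('a list, 'a list filter) bis_struct" where
  "beta_words A = \<lparr>elts = words A, mul = (@), spc = stone_cech (words A),
     emb = (\<lambda>w. principal {w}),
     lact = (\<lambda>v. filtermap (\<lambda>w. v @ w)), ract = (\<lambda>v. filtermap (\<lambda>w. w @ v))\<rparr>"

definition length_preserving ::
    "'b set \<Rightarrow> 'a set \<Rightarrow> ('b list filter \<Rightarrow> 'a list filter) \<Rightarrow> bool" where
  "length_preserving B A f \<longleftrightarrow>
     (\<forall>b\<in>B. \<exists>a\<in>A. f (emb (beta_words B) [b]) = emb (beta_words A) [a])"

section \<open>Vietoris construction\<close>

definition Vietoris :: "'x topology \<Rightarrow> 'x set topology" where
  "Vietoris X = topology_generated_by
     ({{C. closedin X C \<and> C \<inter> U \<noteq> {}} | U. openin X U} \<union>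
      {{C. closedin X C \<and> C \<subseteq> U} | U. openin X U})"

lemma topspace_Vietoris: "topspace (Vietoris X) = {C. closedin X C}"
proof -
  have "{C. closedin X C \<and> C \<subseteq> topspace X} = {C. closedin X C}"
    by (auto dest: closedin_subset)
  then have "{C. closedin X C} \<in> {{C. closedin X C \<and> C \<subseteq> U} | U. openin X U}"
    using openin_topspace by blast
  then show ?thesis
    unfolding Vietoris_def topology_generated_by_topspace by blast
qed

definition Vietoris_image :: "('z \<Rightarrow> 'x) \<Rightarrow> 'z set \<Rightarrow> 'x set" where
  "Vietoris_image g C = g ` C"

definition Vietoris_preimage :: "'z topology \<Rightarrow> ('z \<Rightarrow> 'y) \<Rightarrow> 'y set \<Rightarrow> 'z set" where
  "Vietoris_preimage Z f C = {z \<in> topspace Z. f z \<in> C}"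

definition Vietoris_unit :: "'y \<Rightarrow> 'y set" where
  "Vietoris_unit y = {y}"

definition Vietoris_bis :: "('s, 'x) bis_struct \<Rightarrow> ('s set, 'x set) bis_struct" where
  "Vietoris_bis M = \<lparr>elts = {Q. finite Q \<and> Q \<subseteq> elts M},
     mul = (\<lambda>P Q. {mul M s t | s t. s \<in> P \<and> t \<in> Q}),
     spc = Vietoris (spc M),
     emb = (\<lambda>Q. emb M ` Q),
     lact = (\<lambda>Q C. \<Union>s\<in>Q. lact M s ` C),
     ract = (\<lambda>Q C. \<Union>s\<in>Q. ract M s ` C)\<rparr>"

end

theory Submission
  imports Defs
begin

text \<open>
  The map \<open>h\<close> sends \<open>y\<close> to \<open>g\<close> of the fibre of \<open>f\<close> over \<open>y\<close>. Preimages of the sets \<open>\<box>U\<close> are open because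
  \<open>f\<close> is closed (compact to Hausdorff); preimages of \<open>\<diamond>U\<close> are open because \<open>f\<close> is an open map, being the
  extension \<open>filtermap \<eta>\<close> of a map \<open>\<eta>\<close> of discrete sets. Since \<open>f\<close> is length-preserving, \<open>\<eta>\<close> is
  \<open>map \<phi>\<close> on words, so its fibres over words are finite and multiplicative. A finite fibre stays the
  same in the compactification (an ultrafilter containing a finite set is principal), hence \<open>h\<close> restricts
  to the homomorphism taking \<open>w\<close> to the \<open>g\<close>-values of the words over \<open>w\<close>.
\<close>

section \<open>The Vietoris space of a Boolean space\<close>

text \<open>Alexander's subbase theorem, transferred to the inductively generated topology: that
  topology is the coarsest one in which all of \<S> is open, so it inherits compactness from any
  finer topology on the same points.\<close>

lemma compact_space_generated:
  assumes "\<And>\<C>. \<lbrakk>\<C> \<subseteq> \<S>; \<Union>\<C> = \<Union>\<S>\<rbrakk> \<Longrightarrow> \<exists>\<C>'. finite \<C>' \<and> \<C>' \<subseteq> \<C> \<and> \<Union>\<C>' = \<Union>\<S>"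
  shows "compact_space (topology_generated_by \<S>)"
proof -
  \<comment> \<open>The same subbase in the explicit form used by Alexander's theorem: unions of
    finite intersections, relative to the whole space.\<close>
  define T where
    "T = topology (arbitrary union_of (finite intersection_of (\<lambda>x. x \<in> \<S>) relative_to \<Union>\<S>))"
  have top: "topspace T = \<Union>\<S>"
    by (simp add: T_def)
  have "compact_space T"
    by (rule Alexander_subbase[where \<B> = \<S>]) (use assms top in \<open>auto simp: T_def\<close>)
  moreover have "openin T s" if "s \<in> \<S>" for s
  proof -
    have "(finite intersection_of (\<lambda>x. x \<in> \<S>) relative_to \<Union>\<S>) s"
      using that relative_to_subset_inc[of s "\<Union>\<S>" "finite intersection_of (\<lambda>x. x \<in> \<S>)"]
      by (simp add: Union_upper finite_intersection_of_inc)
    then show ?thesis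
      unfolding T_def openin_subbase by (rule arbitrary_union_of_inc)
  qed
  then have "\<forall>U. openin (topology_generated_by \<S>) U \<longrightarrow> openin T U"
    using generate_topology_on_coarsest[of "openin T" \<S>]
    by (simp add: openin_topology_generated_by_iff)
  ultimately show ?thesis
    unfolding compact_space top topology_generated_by_topspace by simp
qed

text \<open>Having clopen neighbourhoods inside a set passes to binary intersections and to unions,
  so checking it on the subbase suffices.\<close>

lemma generated_clopen_neighbourhood:
  assumes sub: "\<And>s x. \<lbrakk>s \<in> \<S>; x \<in> s\<rbrakk> \<Longrightarrow>
      \<exists>V. openin (topology_generated_by \<S>) V \<and> closedin (topology_generated_by \<S>) V \<and> x \<in> V \<and> V \<subseteq> s"
    and "openin (topology_generated_by \<S>) W" "x \<in> W"
  shows "\<exists>V. openin (topology_generated_by \<S>) V \<and> closedin (topology_generated_by \<S>) V \<and> x \<in> V \<and> V \<subseteq> W"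
  using openin_topology_generated_by[OF assms(2)] assms(3)
proof induction
  case Empty
  then show ?case by simp
next
  case (Int a b)
  then obtain V V' where
    "openin (topology_generated_by \<S>) V" "closedin (topology_generated_by \<S>) V" "x \<in> V" "V \<subseteq> a"
    "openin (topology_generated_by \<S>) V'" "closedin (topology_generated_by \<S>) V'" "x \<in> V'" "V' \<subseteq> b"
    by blast
  then show ?case
    by (intro exI[of _ "V \<inter> V'"]) auto
next
  case (UN K)
  then show ?case
    by (meson Union_iff Union_upper order_trans)
next
  case (Basis s)
  then show ?case
    by (rule sub)
qed

lemma Boolean_space_iff:
  "Boolean_space X \<longleftrightarrow> compact_space X \<and> Hausdorff_space X \<and>
     (\<forall>W x. openin X W \<and> x \<in> W \<longrightarrow> (\<exists>V. openin X V \<and> closedin X V \<and> x \<in> V \<and> V \<subseteq> W))"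
proof -
  have "(\<exists>\<B>. (\<forall>V\<in>\<B>. openin X V \<and> closedin X V) \<and> openin X = arbitrary union_of (\<lambda>V. V \<in> \<B>)) \<longleftrightarrow>
      (\<forall>W x. openin X W \<and> x \<in> W \<longrightarrow> (\<exists>V. openin X V \<and> closedin X V \<and> x \<in> V \<and> V \<subseteq> W))"
    (is "?basis \<longleftrightarrow> ?nbhd")
  proof
    assume ?basis
    then show ?nbhd
      unfolding openin_topology_base_unique by meson
  next
    assume ?nbhd
    then show ?basis
      unfolding openin_topology_base_unique
      by (intro exI[of _ "{V. openin X V \<and> closedin X V}"]) simp
  qed
  then show ?thesis
    by (simp add: Boolean_space_def)
qed

text \<open>A closed set is compact here, so finitely many of the clopen sets inside
  \<open>W\<close> cover it; their union is again clopen.\<close>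

lemma Boolean_space_clopen_between:
  assumes X: "Boolean_space X" and "closedin X C" "openin X W" "C \<subseteq> W"
  obtains V where "openin X V" "closedin X V" "C \<subseteq> V" "V \<subseteq> W"
proof -
  have "compactin X C"
    using assms by (auto simp: Boolean_space_def closedin_compact_space)
  moreover have "C \<subseteq> \<Union>{V. openin X V \<and> closedin X V \<and> V \<subseteq> W}"
    using X[unfolded Boolean_space_iff] assms(3,4)
    by (simp add: subset_iff) metis
  ultimately obtain \<F> where "finite \<F>" "\<F> \<subseteq> {V. openin X V \<and> closedin X V \<and> V \<subseteq> W}" "C \<subseteq> \<Union>\<F>"
    using compactinD[of X C "{V. openin X V \<and> closedin X V \<and> V \<subseteq> W}"] by auto
  then show thesis
    by (intro that[of "\<Union>\<F>"]) (auto intro!: closedin_Union)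
qed

section \<open>The Vietoris topology: clopen sets, compactness, separation, density\<close>

lemma openin_Vietoris_diamond: "openin X U \<Longrightarrow> openin (Vietoris X) {C. closedin X C \<and> C \<inter> U \<noteq> {}}"
  unfolding Vietoris_def by (rule topology_generated_by_Basis) blast

lemma openin_Vietoris_box: "openin X U \<Longrightarrow> openin (Vietoris X) {C. closedin X C \<and> C \<subseteq> U}"
  unfolding Vietoris_def by (rule topology_generated_by_Basis) blast

text \<open>Diamond and box are dual under complement. Hence clopen sets of \<open>X\<close> yield
  clopen diamonds and boxes.\<close>

lemma closedin_Vietoris_diamond:
  assumes "closedin X K"
  shows "closedin (Vietoris X) {C. closedin X C \<and> C \<inter> K \<noteq> {}}"
proof -
  have "topspace (Vietoris X) - {C. closedin X C \<and> C \<inter> K \<noteq> {}}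
      = {C. closedin X C \<and> C \<subseteq> topspace X - K}"
    by (auto simp: topspace_Vietoris dest: closedin_subset)
  then show ?thesis
    using openin_Vietoris_box[of X "topspace X - K"] assms
    by (auto simp: closedin_def[of "Vietoris X"] topspace_Vietoris)
qed

lemma closedin_Vietoris_box:
  assumes "closedin X K"
  shows "closedin (Vietoris X) {C. closedin X C \<and> C \<subseteq> K}"
proof -
  have "topspace (Vietoris X) - {C. closedin X C \<and> C \<subseteq> K}
      = {C. closedin X C \<and> C \<inter> (topspace X - K) \<noteq> {}}"
    by (auto simp: topspace_Vietoris dest: closedin_subset)
  then show ?thesis
    using openin_Vietoris_diamond[of X "topspace X - K"] assms
    by (auto simp: closedin_def[of "Vietoris X"] topspace_Vietoris)
qed

text \<open>By Alexander's theorem only covers by diamonds and boxes matter. One box and finitely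
  many diamonds of such a cover suffice: the box is found by asking which member contains the
  complement of all the diamond sets, and compactness of \<open>X\<close> does the rest.\<close>

lemma compact_space_Vietoris:
  assumes X: "compact_space X"
  shows "compact_space (Vietoris X)"
  unfolding Vietoris_def
proof (rule compact_space_generated)
  let ?dia = "\<lambda>U. {C. closedin X C \<and> C \<inter> U \<noteq> {}}"
  let ?box = "\<lambda>U. {C. closedin X C \<and> C \<subseteq> U}"
  let ?S = "{?dia U | U. openin X U} \<union> {?box U | U. openin X U}"
  have S: "\<Union>?S = {C. closedin X C}"
    using topspace_Vietoris[of X] by (simp only: Vietoris_def topology_generated_by_topspace)
  fix \<C>
  assume sub: "\<C> \<subseteq> ?S" and cov: "\<Union>\<C> = \<Union>?S"
  define \<U> where "\<U> = {U. openin X U \<and> ?dia U \<in> \<C>}"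
  have \<U>: "openin X (\<Union>\<U>)"
    by (auto simp: \<U>_def)
  \<comment> \<open>As a point of the Vietoris space, \<open>?K\<close> lies in no diamond of the
    cover, so it must be covered by a box.\<close>
  let ?K = "topspace X - \<Union>\<U>"
  have K: "closedin X ?K"
    using \<U> by blast
  then have "?K \<in> \<Union>\<C>"
    by (simp only: cov S mem_Collect_eq)
  then obtain c where c: "c \<in> \<C>" "?K \<in> c" by blast
  have "c \<noteq> ?dia U" if "openin X U" for U
  proof
    assume cU: "c = ?dia U"
    with that c(1) have "U \<in> \<U>"
      by (simp add: \<U>_def)
    then have "?K \<inter> U = {}" by blast
    with c(2) show False
      by (simp add: cU)
  qed
  moreover have "(\<exists>U. c = ?dia U \<and> openin X U) \<or> (\<exists>U. c = ?box U \<and> openin X U)"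
    using subsetD[OF sub c(1)] by (simp only: Un_iff mem_Collect_eq)
  ultimately obtain W where W: "openin X W" "c = ?box W"
    by metis
  then have "?K \<subseteq> W"
    using c(2) by simp
  then have "topspace X \<subseteq> \<Union>(insert W \<U>)"
    by auto
  moreover have "\<And>U. U \<in> insert W \<U> \<Longrightarrow> openin X U"
    using W by (auto simp: \<U>_def)
  ultimately obtain \<F> where \<F>: "finite \<F>" "\<F> \<subseteq> insert W \<U>" "topspace X \<subseteq> \<Union>\<F>"
    using compactinD[of X "topspace X" "insert W \<U>"] X unfolding compact_space_def by blast
  \<comment> \<open>\<open>c\<close> is the box of \<open>W\<close>. The intersection with
    \<open>\<U>\<close> keeps only those sets whose diamond is known to belong to the cover, since
    \<F> may also contain \<open>W\<close>.\<close>
  define \<C>' where "\<C>' = insert c (?dia ` (\<F> \<inter> \<U>))"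
  have "finite \<C>'"
    using \<F> by (simp add: \<C>'_def)
  moreover have C': "\<C>' \<subseteq> \<C>"
    using c by (auto simp: \<C>'_def \<U>_def)
  \<comment> \<open>A closed set inside \<open>W\<close> lies in the box \<open>c\<close>; any other
    has a point outside \<open>W\<close>, and that point lies in some member of \<F> taken from
    \<open>\<U>\<close>, so its diamond contains the set.\<close>
  moreover have "C \<in> \<Union>\<C>'" if C: "closedin X C" for C
  proof (cases "C \<subseteq> W")
    case True
    then show ?thesis
      using C W by (auto simp: \<C>'_def)
  next
    case False
    then obtain x where "x \<in> C" "x \<notin> W" by blast
    moreover have "x \<in> topspace X"
      using \<open>x \<in> C\<close> C closedin_subset by blast
    ultimately obtain U where "U \<in> \<F> \<inter> \<U>" "x \<in> U"
      using \<F> by blast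
    then show ?thesis
      using C \<open>x \<in> C\<close> by (auto simp: \<C>'_def)
  qed
  then have "\<Union>?S \<subseteq> \<Union>\<C>'"
    unfolding S by blast
  moreover have "\<Union>\<C>' \<subseteq> \<Union>?S"
    unfolding cov[symmetric] using C' by (rule Union_mono)
  ultimately show "\<exists>\<C>'. finite \<C>' \<and> \<C>' \<subseteq> \<C> \<and> \<Union>\<C>' = \<Union>?S"
    by (intro exI[of _ \<C>'] conjI equalityI)
qed

text \<open>Distinct closed sets differ in a point \<open>x\<close> of one of them. Separating
  \<open>x\<close> from the other set by open \<open>U\<close> and \<open>V\<close> makes the
  diamond of \<open>U\<close> and the box of \<open>V\<close> disjoint neighbourhoods.\<close>

lemma Hausdorff_space_Vietoris:
  assumes X: "compact_space X" "Hausdorff_space X"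
  shows "Hausdorff_space (Vietoris X)"
proof -
  have sep: "\<exists>U V. openin (Vietoris X) U \<and> openin (Vietoris X) V \<and> C \<in> U \<and> D \<in> V \<and> disjnt U V"
    if CD: "closedin X C" "closedin X D" and x: "x \<in> C" "x \<notin> D" for C D x
  proof -
    have "x \<in> topspace X"
      using CD x closedin_subset by blast
    then obtain U V where UV: "openin X U" "openin X V" "{x} \<subseteq> U" "D \<subseteq> V" "disjnt U V"
      using Hausdorff_space_compact_separation[OF X(2), of "{x}" D] CD x
      by (auto simp: closedin_compact_space[OF X(1)])
    show ?thesis
      using openin_Vietoris_diamond[OF UV(1)] openin_Vietoris_box[OF UV(2)] UV CD x
      by (intro exI[of _ "{C. closedin X C \<and> C \<inter> U \<noteq> {}}"] exI[of _ "{C. closedin X C \<and> C \<subseteq> V}"])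
        (auto simp: disjnt_iff)
  qed
  show ?thesis
    unfolding Hausdorff_space_def
  proof (intro allI impI)
    fix C D
    assume *: "C \<in> topspace (Vietoris X) \<and> D \<in> topspace (Vietoris X) \<and> C \<noteq> D"
    then have CD: "closedin X C" "closedin X D"
      by (auto simp: topspace_Vietoris)
    from * consider x where "x \<in> C" "x \<notin> D" | x where "x \<in> D" "x \<notin> C"
      by blast
    then show "\<exists>U V. openin (Vietoris X) U \<and> openin (Vietoris X) V \<and> C \<in> U \<and> D \<in> V \<and> disjnt U V"
    proof cases
      case 1
      then show ?thesis by (rule sep[OF CD])
    next
      case 2
      from sep[OF CD(2,1) this] show ?thesis
        by (metis disjnt_sym)
    qed
  qed
qed

text \<open>Clopen neighbourhoods are needed only inside subbasic sets. A diamond shrinks to the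
  diamond of a clopen neighbourhood of one point, a box to the box of a clopen set in
  between.\<close>

lemma Boolean_space_Vietoris:
  assumes X: "Boolean_space X"
  shows "Boolean_space (Vietoris X)"
  unfolding Boolean_space_iff
proof (intro conjI allI impI; (elim conjE)?)
  show "compact_space (Vietoris X)" "Hausdorff_space (Vietoris X)"
    using X compact_space_Vietoris Hausdorff_space_Vietoris by (auto simp: Boolean_space_def)
  fix W C
  assume "openin (Vietoris X) W" "C \<in> W"
  then show "\<exists>V. openin (Vietoris X) V \<and> closedin (Vietoris X) V \<and> C \<in> V \<and> V \<subseteq> W"
    unfolding Vietoris_def
  proof (rule generated_clopen_neighbourhood[rotated])
    fix s C
    assume s: "s \<in> {{C. closedin X C \<and> C \<inter> U \<noteq> {}} |U. openin X U} \<union>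
                {{C. closedin X C \<and> C \<subseteq> U} |U. openin X U}" and C: "C \<in> s"
    from s consider
        U where "openin X U" "s = {C. closedin X C \<and> C \<inter> U \<noteq> {}}"
      | U where "openin X U" "s = {C. closedin X C \<and> C \<subseteq> U}"
      by blast
    then have "\<exists>V. openin (Vietoris X) V \<and> closedin (Vietoris X) V \<and> C \<in> V \<and> V \<subseteq> s"
    proof cases
      case 1
      then obtain x where x: "closedin X C" "x \<in> C" "x \<in> U"
        using C by blast
      obtain V where V: "openin X V" "closedin X V" "x \<in> V" "V \<subseteq> U"
        using X 1(1) x(3) unfolding Boolean_space_iff by blast
      show ?thesis
        using openin_Vietoris_diamond[OF V(1)] closedin_Vietoris_diamond[OF V(2)] V x 1
        by (intro exI[of _ "{C. closedin X C \<and> C \<inter> V \<noteq> {}}"]) auto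
    next
      case 2
      then have "closedin X C" "C \<subseteq> U"
        using C by auto
      then obtain V where V: "openin X V" "closedin X V" "C \<subseteq> V" "V \<subseteq> U"
        using Boolean_space_clopen_between[OF X _ 2(1)] by blast
      show ?thesis
        using openin_Vietoris_box[OF V(1)] closedin_Vietoris_box[OF V(2)] V \<open>closedin X C\<close> 2
        by (intro exI[of _ "{C. closedin X C \<and> C \<subseteq> V}"]) auto
    qed
    then show "\<exists>V. openin (topology_generated_by
               ({{C. closedin X C \<and> C \<inter> U \<noteq> {}} |U. openin X U} \<union>
                {{C. closedin X C \<and> C \<subseteq> U} |U. openin X U})) V \<and>
              closedin (topology_generated_by
               ({{C. closedin X C \<and> C \<inter> U \<noteq> {}} |U. openin X U} \<union>
                {{C. closedin X C \<and> C \<subseteq> U} |U. openin X U})) V \<and> C \<in> V \<and> V \<subseteq> s"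
      unfolding Vietoris_def .
  qed
qed

text \<open>Boxes are closed under finite intersection, so a basic neighbourhood consists of one box
  and finitely many diamonds.\<close>

lemma Vietoris_neighbourhood:
  assumes "openin (Vietoris X) W" "C \<in> W"
  shows "\<exists>U \<U>. openin X U \<and> C \<subseteq> U \<and> finite \<U> \<and> (\<forall>V\<in>\<U>. openin X V \<and> C \<inter> V \<noteq> {}) \<and>
    (\<forall>D. closedin X D \<and> D \<subseteq> U \<and> (\<forall>V\<in>\<U>. D \<inter> V \<noteq> {}) \<longrightarrow> D \<in> W)"
  using openin_topology_generated_by[OF assms(1)[unfolded Vietoris_def]] assms(2)
proof induction
  case Empty
  then show ?case by simp
next
  case (Int a b)
  from Int.IH(1) Int.prems obtain U \<U> where
    1: "openin X U" "C \<subseteq> U" "finite \<U>" "\<forall>V\<in>\<U>. openin X V \<and> C \<inter> V \<noteq> {}"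
      "\<forall>D. closedin X D \<and> D \<subseteq> U \<and> (\<forall>V\<in>\<U>. D \<inter> V \<noteq> {}) \<longrightarrow> D \<in> a"
    by auto
  from Int.IH(2) Int.prems obtain U' \<U>' where
    2: "openin X U'" "C \<subseteq> U'" "finite \<U>'" "\<forall>V\<in>\<U>'. openin X V \<and> C \<inter> V \<noteq> {}"
      "\<forall>D. closedin X D \<and> D \<subseteq> U' \<and> (\<forall>V\<in>\<U>'. D \<inter> V \<noteq> {}) \<longrightarrow> D \<in> b"
    by auto
  show ?case
  proof (intro exI conjI)
    show "openin X (U \<inter> U')" "C \<subseteq> U \<inter> U'" "finite (\<U> \<union> \<U>')"
      using 1(1-3) 2(1-3) by auto
    show "\<forall>V\<in>\<U> \<union> \<U>'. openin X V \<and> C \<inter> V \<noteq> {}"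
      using 1(4) 2(4) by blast
    show "\<forall>D. closedin X D \<and> D \<subseteq> U \<inter> U' \<and> (\<forall>V\<in>\<U> \<union> \<U>'. D \<inter> V \<noteq> {}) \<longrightarrow> D \<in> a \<inter> b"
      using 1(5) 2(5) by simp
  qed
next
  case (UN K)
  then obtain k where k: "k \<in> K" "C \<in> k" by blast
  from UN.IH[OF k] obtain U \<U> where
    "openin X U" "C \<subseteq> U" "finite \<U>" "\<forall>V\<in>\<U>. openin X V \<and> C \<inter> V \<noteq> {}"
    and "\<forall>D. closedin X D \<and> D \<subseteq> U \<and> (\<forall>V\<in>\<U>. D \<inter> V \<noteq> {}) \<longrightarrow> D \<in> k"
    by auto
  with k(1) show ?case
    by (intro exI[of _ U] exI[of _ \<U>]) auto
next
  case (Basis s)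
  then consider
      U where "openin X U" "s = {C. closedin X C \<and> C \<inter> U \<noteq> {}}"
    | U where "openin X U" "s = {C. closedin X C \<and> C \<subseteq> U}"
    by blast
  then show ?case
  proof cases
    case 1
    then show ?thesis
      using Basis(2) by (intro exI[of _ "topspace X"] exI[of _ "{U}"]) (auto dest: closedin_subset)
  next
    case 2
    then show ?thesis
      using Basis(2) by (intro exI[of _ U] exI[of _ "{}"]) auto
  qed
qed

text \<open>In a basic neighbourhood with box \<open>U\<close> and diamonds \<open>\<U>\<close>,
  pick a point of \<open>S\<close> in each \<open>U \<inter> V\<close>. These finitely many points
  form a member of the neighbourhood; without diamonds it is the empty set.\<close>

lemma dense_finite_subsets_Vietoris:
  assumes X: "Hausdorff_space X" and S: "X closure_of S = topspace X" "S \<subseteq> topspace X"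
  shows "Vietoris X closure_of {Q. finite Q \<and> Q \<subseteq> S} = topspace (Vietoris X)"
  unfolding dense_intersects_open
proof (intro allI impI)
  fix W
  assume "openin (Vietoris X) W \<and> W \<noteq> {}"
  then obtain C where "openin (Vietoris X) W" "C \<in> W" by blast
  from Vietoris_neighbourhood[OF this] obtain U \<U> where
    U: "openin X U" "C \<subseteq> U" "finite \<U>" "\<forall>V\<in>\<U>. openin X V \<and> C \<inter> V \<noteq> {}"
    and sub: "\<forall>D. closedin X D \<and> D \<subseteq> U \<and> (\<forall>V\<in>\<U>. D \<inter> V \<noteq> {}) \<longrightarrow> D \<in> W"
    by auto
  have "\<exists>q. q \<in> S \<inter> (U \<inter> V)" if "V \<in> \<U>" for V
  proof -
    have "openin X (U \<inter> V)" "U \<inter> V \<noteq> {}"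
      using U that by auto
    then show ?thesis
      using S(1)[unfolded dense_intersects_open] by blast
  qed
  then obtain q where q: "\<And>V. V \<in> \<U> \<Longrightarrow> q V \<in> S \<inter> (U \<inter> V)"
    by metis
  have "closedin X (q ` \<U>)"
    using U(3) q S(2) Hausdorff_imp_t1_space[OF X] unfolding t1_space_closedin_finite
    by (meson IntD1 finite_imageI image_subsetI subsetD)
  moreover have "q ` \<U> \<subseteq> U" "\<forall>V\<in>\<U>. q ` \<U> \<inter> V \<noteq> {}"
    using q by blast+
  ultimately have "q ` \<U> \<in> W"
    using sub by blast
  moreover have "q ` \<U> \<in> {Q. finite Q \<and> Q \<subseteq> S}"
    using U(3) q by blast
  ultimately show "{Q. finite Q \<and> Q \<subseteq> S} \<inter> W \<noteq> {}"
    by blast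
qed

section \<open>Continuous maps into Vietoris spaces\<close>

lemma continuous_map_into_Vietoris:
  assumes "\<And>y. y \<in> topspace Y \<Longrightarrow> closedin X (F y)"
    and "\<And>U. openin X U \<Longrightarrow> openin Y {y \<in> topspace Y. F y \<inter> U \<noteq> {}}"
    and "\<And>U. openin X U \<Longrightarrow> openin Y {y \<in> topspace Y. F y \<subseteq> U}"
  shows "continuous_map Y (Vietoris X) F"
  unfolding Vietoris_def
proof (rule continuous_on_generated_topo)
  fix s
  assume s: "s \<in> {{C. closedin X C \<and> C \<inter> U \<noteq> {}} |U. openin X U} \<union>
                {{C. closedin X C \<and> C \<subseteq> U} |U. openin X U}"
  from s consider
      U where "openin X U" "s = {C. closedin X C \<and> C \<inter> U \<noteq> {}}"
    | U where "openin X U" "s = {C. closedin X C \<and> C \<subseteq> U}"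
    by blast
  then show "openin Y (F -` s \<inter> topspace Y)"
  proof cases
    case 1
    then have "F -` s \<inter> topspace Y = {y \<in> topspace Y. F y \<inter> U \<noteq> {}}"
      using assms(1) by auto
    then show ?thesis using assms(2) 1 by simp
  next
    case 2
    then have "F -` s \<inter> topspace Y = {y \<in> topspace Y. F y \<subseteq> U}"
      using assms(1) by auto
    then show ?thesis using assms(3) 2 by simp
  qed
next
  show "F ` topspace Y \<subseteq> \<Union> ({{C. closedin X C \<and> C \<inter> U \<noteq> {}} |U. openin X U} \<union>
            {{C. closedin X C \<and> C \<subseteq> U} |U. openin X U})"
    using assms(1) topspace_Vietoris[of X] 
    unfolding Vietoris_def topology_generated_by_topspace by blast
qed

text \<open>This gives continuity of the actions of a finite set \<open>Q\<close>. A diamond pulls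
  back to the diamond of a union of preimages, a box to the box of an intersection, which is open
  because \<open>Q\<close> is finite.\<close>

lemma continuous_map_Vietoris_finite_Union:
  assumes "compact_space X" "Hausdorff_space Y" "finite Q"
    and cont: "\<And>s. s \<in> Q \<Longrightarrow> continuous_map X Y (l s)"
  shows "continuous_map (Vietoris X) (Vietoris Y) (\<lambda>C. \<Union>s\<in>Q. l s ` C)"
proof (rule continuous_map_into_Vietoris)
  fix C
  assume "C \<in> topspace (Vietoris X)"
  then show "closedin Y (\<Union>s\<in>Q. l s ` C)"
    using assms(3) continuous_imp_closed_map[OF cont assms(1,2)]
    by (auto intro!: closedin_Union simp: topspace_Vietoris closed_map_def)
next
  fix U
  assume U: "openin Y U"
  let ?V = "\<lambda>s. {x \<in> topspace X. l s x \<in> U}"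
  have "openin X (\<Union>s\<in>Q. ?V s)"
    using openin_continuous_map_preimage[OF cont U] by blast
  moreover have "{C \<in> topspace (Vietoris X). (\<Union>s\<in>Q. l s ` C) \<inter> U \<noteq> {}}
      = {C. closedin X C \<and> C \<inter> (\<Union>s\<in>Q. ?V s) \<noteq> {}}"
    by (auto simp: topspace_Vietoris dest: closedin_subset)
  ultimately show "openin (Vietoris X) {C \<in> topspace (Vietoris X). (\<Union>s\<in>Q. l s ` C) \<inter> U \<noteq> {}}"
    by (simp only: openin_Vietoris_diamond)
  \<comment> \<open>Intersecting with \<open>topspace X\<close> covers the case of empty
    \<open>Q\<close>, where the indexed intersection is the whole type.\<close>
  have "openin X (topspace X \<inter> (\<Inter>s\<in>Q. ?V s))"
    using openin_continuous_map_preimage[OF cont U] assms(3) 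
    by (cases "Q = {}") (auto intro!: openin_Int openin_INT2)
  moreover have "{C \<in> topspace (Vietoris X). (\<Union>s\<in>Q. l s ` C) \<subseteq> U}
      = {C. closedin X C \<and> C \<subseteq> topspace X \<inter> (\<Inter>s\<in>Q. ?V s)}"
    by (auto simp: topspace_Vietoris dest: closedin_subset)
  ultimately show "openin (Vietoris X) {C \<in> topspace (Vietoris X). (\<Union>s\<in>Q. l s ` C) \<subseteq> U}"
    by (simp only: openin_Vietoris_box)
qed

lemma continuous_map_Vietoris_fibres:
  assumes "compact_space Z" "Hausdorff_space Y" "Hausdorff_space X"
    and f: "continuous_map Z Y f" "open_map Z Y f" and g: "continuous_map Z X g"
  shows "continuous_map Y (Vietoris X) (\<lambda>y. g ` {z \<in> topspace Z. f z = y})"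
proof (rule continuous_map_into_Vietoris)
  fix y
  assume "y \<in> topspace Y"
  then have "closedin Y {y}"
    using Hausdorff_imp_t1_space[OF assms(2)] by (simp add: t1_space_closedin_singleton)
  from closedin_continuous_map_preimage[OF f(1) this]
  show "closedin X (g ` {z \<in> topspace Z. f z = y})"
    using continuous_imp_closed_map[OF g assms(1,3)] by (simp add: closed_map_def)
next
  fix U
  assume U: "openin X U"
  let ?V = "{z \<in> topspace Z. g z \<in> U}"
  have V: "openin Z ?V"
    by (rule openin_continuous_map_preimage[OF g U])
  have fim: "f ` topspace Z \<subseteq> topspace Y"
    by (rule continuous_map_image_subset_topspace[OF f(1)])
  \<comment> \<open>The fibre image over \<open>y\<close> meets \<open>U\<close> exactly when
    \<open>y\<close> is the \<open>f\<close>-value of a point of \<open>?V\<close>; this is where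
    openness of \<open>f\<close> enters.\<close>
  have "{y \<in> topspace Y. g ` {z \<in> topspace Z. f z = y} \<inter> U \<noteq> {}} = f ` ?V"
    using fim by blast
  then show "openin Y {y \<in> topspace Y. g ` {z \<in> topspace Z. f z = y} \<inter> U \<noteq> {}}"
    using f(2) V by (simp add: open_map_def)
  have "closedin Y (f ` (topspace Z - ?V))"
    using continuous_imp_closed_map[OF f(1) assms(1,2)] V by (auto simp: closed_map_def)
  \<comment> \<open>The fibre image leaves \<open>U\<close> exactly when \<open>y\<close> is the
    \<open>f\<close>-value of a point outside \<open>?V\<close>; such values form a closed
    set.\<close>
  moreover have "{y \<in> topspace Y. g ` {z \<in> topspace Z. f z = y} \<subseteq> U}
      = topspace Y - f ` (topspace Z - ?V)"
    using fim by blast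
  ultimately show "openin Y {y \<in> topspace Y. g ` {z \<in> topspace Z. f z = y} \<subseteq> U}"
    by (metis openin_diff openin_topspace)
qed

section \<open>The Vietoris of a BiS is a BiS\<close>

lemma bis_Vietoris_bis:
  assumes "bis M"
  shows "bis (Vietoris_bis M)"
proof -
  interpret bis M by fact
  have X: "compact_space (spc M)" "Hausdorff_space (spc M)"
    using Boolean by (auto simp: Boolean_space_def)
  have S: "emb M ` elts M \<subseteq> topspace (spc M)"
    using emb_closed by blast
  show ?thesis
  proof
    fix P Q
    assume PQ: "P \<in> elts (Vietoris_bis M)" "Q \<in> elts (Vietoris_bis M)"
    \<comment> \<open>The product is an image of \<open>P \<times> Q\<close>, which makes its
      finiteness evident.\<close>
    have "{mul M s t |s t. s \<in> P \<and> t \<in> Q} = (\<lambda>(s, t). mul M s t) ` (P \<times> Q)"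
      by auto
    with PQ show "mul (Vietoris_bis M) P Q \<in> elts (Vietoris_bis M)"
      by (auto simp: Vietoris_bis_def intro: mul_closed)
    from PQ have sub: "P \<subseteq> elts M" "Q \<subseteq> elts M"
      by (auto simp: Vietoris_bis_def)
    show "lact (Vietoris_bis M) P (emb (Vietoris_bis M) Q) = emb (Vietoris_bis M) (mul (Vietoris_bis M) P Q)"
    proof -
      have "lact M s (emb M t) = emb M (mul M s t)" if "s \<in> P" "t \<in> Q" for s t
        using that sub lact_extends by blast
      then show ?thesis
        by (simp add: Vietoris_bis_def) (auto simp: image_iff, (metis+)?)
    qed
    show "ract (Vietoris_bis M) P (emb (Vietoris_bis M) Q) = emb (Vietoris_bis M) (mul (Vietoris_bis M) Q P)"
    proof -
      have "ract M s (emb M t) = emb M (mul M t s)" if "s \<in> P" "t \<in> Q" for s t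
        using that sub ract_extends by blast
      then show ?thesis
        by (simp add: Vietoris_bis_def) (auto simp: image_iff, (metis+)?)
    qed
    fix R
    assume R: "R \<in> elts (Vietoris_bis M)"
    then have "mul M (mul M s t) r = mul M s (mul M t r)" if "s \<in> P" "t \<in> Q" "r \<in> R" for r s t
      using that sub mul_assoc by (simp add: Vietoris_bis_def subset_iff)
    then show "mul (Vietoris_bis M) (mul (Vietoris_bis M) P Q) R
        = mul (Vietoris_bis M) P (mul (Vietoris_bis M) Q R)"
      by (simp add: Vietoris_bis_def) (safe; metis)
  next
    show "Boolean_space (spc (Vietoris_bis M))"
      using Boolean_space_Vietoris[OF Boolean] by (simp add: Vietoris_bis_def)
  next
    fix Q
    assume Q: "Q \<in> elts (Vietoris_bis M)"
    show "emb (Vietoris_bis M) Q \<in> topspace (spc (Vietoris_bis M))"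
    proof -
      have "finite (emb M ` Q)" "emb M ` Q \<subseteq> topspace (spc M)"
        using Q S by (auto simp: Vietoris_bis_def)
      then show ?thesis
        using Hausdorff_imp_t1_space[OF X(2)]
        by (simp add: Vietoris_bis_def topspace_Vietoris t1_space_closedin_finite)
    qed
    show "continuous_map (spc (Vietoris_bis M)) (spc (Vietoris_bis M)) (lact (Vietoris_bis M) Q)"
      using Q lact_continuous continuous_map_Vietoris_finite_Union[OF X, of Q "lact M"]
      by (auto simp: Vietoris_bis_def)
    show "continuous_map (spc (Vietoris_bis M)) (spc (Vietoris_bis M)) (ract (Vietoris_bis M) Q)"
      using Q ract_continuous continuous_map_Vietoris_finite_Union[OF X, of Q "ract M"]
      by (auto simp: Vietoris_bis_def)
  next
    show "inj_on (emb (Vietoris_bis M)) (elts (Vietoris_bis M))"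
      using emb_inj by (simp add: Vietoris_bis_def inj_on_def[of "image _"] inj_on_image_eq_iff)
  next
    \<comment> \<open>Every finite subset of the embedded semigroup comes from a finite set of
      elements, so the density lemma applies.\<close>
    have "emb (Vietoris_bis M) ` elts (Vietoris_bis M) = {Q. finite Q \<and> Q \<subseteq> emb M ` elts M}"
    proof (intro equalityI subsetI)
      fix R
      assume "R \<in> {Q. finite Q \<and> Q \<subseteq> emb M ` elts M}"
      then obtain Q where "Q \<subseteq> elts M" "finite Q" "R = emb M ` Q"
        using finite_subset_image[of R "emb M" "elts M"] by blast
      then show "R \<in> emb (Vietoris_bis M) ` elts (Vietoris_bis M)"
        by (simp add: Vietoris_bis_def)
    qed (auto simp: Vietoris_bis_def)
    then show "spc (Vietoris_bis M) closure_of emb (Vietoris_bis M) ` elts (Vietoris_bis M)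
        = topspace (spc (Vietoris_bis M))"
      using dense_finite_subsets_Vietoris[OF X(2) emb_dense S]
      by (simp add: Vietoris_bis_def)
  qed
qed

section \<open>Maps between Stone-Cech compactifications\<close>

lemma principal_in_ultrafilters_on: "d \<in> D \<Longrightarrow> principal {d} \<in> ultrafilters_on D"
  by (simp add: ultrafilters_on_def eventually_principal principal_eq_bot_iff)

lemma filtermap_in_ultrafilters_on:
  "\<lbrakk>u \<in> ultrafilters_on D; \<eta> ` D \<subseteq> E\<rbrakk> \<Longrightarrow> filtermap \<eta> u \<in> ultrafilters_on E"
  by (auto simp: ultrafilters_on_def eventually_filtermap filtermap_bot_iff elim!: eventually_mono)

text \<open>Smaller filters have more eventual properties, and ultrafilters are minimal among the
  proper ones: a property of \<open>v\<close> failing in \<open>u\<close> would have its negation in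
  \<open>u\<close>, hence in \<open>v\<close>.\<close>

lemma ultrafilter_le_imp_eq:
  assumes "u \<in> ultrafilters_on D" "v \<noteq> bot" "v \<le> u"
  shows "v = u"
proof (rule antisym[OF assms(3)], rule filter_leI)
  fix P
  assume "eventually P v"
  moreover have "eventually P u \<or> eventually (\<lambda>x. \<not> P x) u"
    using assms(1) by (simp add: ultrafilters_on_def)
  moreover have "\<not> eventually (\<lambda>x. \<not> P x) v" if "eventually P v"
  proof
    assume "eventually (\<lambda>x. \<not> P x) v"
    with that have "eventually (\<lambda>x. False) v"
      by eventually_elim blast
    with assms(2) show False
      by (simp add: trivial_limit_def)
  qed
  ultimately show "eventually P u"
    using assms(3) filter_leD by blast
qed

lemma ultrafilter_finite_principal:
  assumes u: "u \<in> ultrafilters_on D" and F: "finite F" "eventually (\<lambda>x. x \<in> F) u"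
  shows "\<exists>d\<in>F. u = principal {d}"
proof -
  have "\<not> (\<forall>d\<in>F. eventually (\<lambda>x. x \<noteq> d) u)"
  proof
    assume "\<forall>d\<in>F. eventually (\<lambda>x. x \<noteq> d) u"
    then have "eventually (\<lambda>x. \<forall>d\<in>F. x \<noteq> d) u"
      by (rule eventually_ball_finite[OF F(1)])
    with F(2) have "eventually (\<lambda>x. False) u"
      by eventually_elim blast
    with u show False
      by (simp add: ultrafilters_on_def trivial_limit_def)
  qed
  then obtain d where d: "d \<in> F" "\<not> eventually (\<lambda>x. x \<noteq> d) u"
    by blast
  then have "eventually (\<lambda>x. \<not> x \<noteq> d) u"
    using u by (force simp: ultrafilters_on_def)
  then have "u \<le> principal {d}"
    by (simp add: le_principal)
  \<comment> \<open>\<open>principal {d}\<close> is itself an ultrafilter, here on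
    \<open>UNIV\<close>, so minimality forces equality.\<close>
  then have "u = principal {d}"
    using ultrafilter_le_imp_eq[OF principal_in_ultrafilters_on[of d UNIV]] u
    by (auto simp: ultrafilters_on_def)
  with d show ?thesis by blast
qed

section \<open>Topology and maps of the Stone-Cech compactification\<close>

lemma openin_stone_cech_basic:
  "P \<subseteq> D \<Longrightarrow> openin (stone_cech D) {u \<in> ultrafilters_on D. eventually (\<lambda>x. x \<in> P) u}"
  unfolding stone_cech_def by (rule topology_generated_by_Basis) blast

text \<open>The generating sets already form a base: those of \<open>P\<close> and \<open>Q\<close>
  intersect in that of \<open>P \<inter> Q\<close>.\<close>

lemma stone_cech_basic_neighbourhood:
  assumes "openin (stone_cech D) W" "u \<in> W"
  shows "\<exists>P\<subseteq>D. eventually (\<lambda>x. x \<in> P) u \<and>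
    {u \<in> ultrafilters_on D. eventually (\<lambda>x. x \<in> P) u} \<subseteq> W"
  using openin_topology_generated_by[OF assms(1)[unfolded stone_cech_def]] assms(2)
proof induction
  case Empty
  then show ?case by simp
next
  case (Int a b)
  then obtain P Q where "P \<subseteq> D" "eventually (\<lambda>x. x \<in> P) u"
      "{u \<in> ultrafilters_on D. eventually (\<lambda>x. x \<in> P) u} \<subseteq> a"
      "eventually (\<lambda>x. x \<in> Q) u" "{u \<in> ultrafilters_on D. eventually (\<lambda>x. x \<in> Q) u} \<subseteq> b"
    by auto
  then show ?case
    by (intro exI[of _ "P \<inter> Q"]) (auto simp: eventually_conj_iff)
next
  case (UN K)
  then show ?case
    by (meson Union_iff Union_upper order_trans)
next
  case (Basis s)
  then show ?case by blast
qed

text \<open>By minimality it is enough that each property \<open>R\<close> of \<open>f u\<close>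
  holds in \<open>filtermap \<eta> u\<close>. Continuity turns \<open>R\<close> into a set
  \<open>P\<close> of \<open>u\<close> whose basic open set maps into that of \<open>R\<close>;
  testing on the principal filters at points of \<open>P\<close> gives \<open>R (\<eta> x)\<close>
  there.\<close>

lemma stone_cech_map_eq_filtermap:
  assumes f: "continuous_map (stone_cech D) (stone_cech E) f"
    and \<eta>: "\<And>d. d \<in> D \<Longrightarrow> \<eta> d \<in> E \<and> f (principal {d}) = principal {\<eta> d}"
    and u: "u \<in> ultrafilters_on D"
  shows "f u = filtermap \<eta> u"
proof -
  have fu: "f u \<in> ultrafilters_on E"
    using continuous_map_image_subset_topspace[OF f] u by (auto simp: topspace_stone_cech)
  have "filtermap \<eta> u \<le> f u"
  proof (rule filter_leI)
    fix R
    assume R: "eventually R (f u)"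
    let ?W = "{v \<in> ultrafilters_on E. eventually (\<lambda>y. y \<in> {y \<in> E. R y}) v}"
    have "f u \<in> ?W"
      using fu R by (auto simp: ultrafilters_on_def eventually_conj_iff)
    moreover have "openin (stone_cech D) {w \<in> topspace (stone_cech D). f w \<in> ?W}"
      by (intro openin_continuous_map_preimage[OF f] openin_stone_cech_basic) auto
    ultimately obtain P where P: "P \<subseteq> D" "eventually (\<lambda>x. x \<in> P) u"
        "{w \<in> ultrafilters_on D. eventually (\<lambda>x. x \<in> P) w} \<subseteq> {w \<in> topspace (stone_cech D). f w \<in> ?W}"
      using stone_cech_basic_neighbourhood[of D "{w \<in> topspace (stone_cech D). f w \<in> ?W}" u] u
      by (auto simp: topspace_stone_cech)
    have "R (\<eta> x)" if "x \<in> P" for x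
    proof -
      have "principal {x} \<in> {w \<in> ultrafilters_on D. eventually (\<lambda>x. x \<in> P) w}"
        using that P(1) by (auto simp: eventually_principal intro: principal_in_ultrafilters_on)
      then have "f (principal {x}) \<in> ?W"
        using P(3) by blast
      then show ?thesis
        using \<eta>[of x] that P(1) by (auto simp: eventually_principal)
    qed
    with P(2) show "eventually R (filtermap \<eta> u)"
      unfolding eventually_filtermap by (rule eventually_mono)
  qed
  moreover have "filtermap \<eta> u \<noteq> bot"
    using u by (simp add: ultrafilters_on_def filtermap_bot_iff)
  ultimately show ?thesis
    using ultrafilter_le_imp_eq[OF fu] by metis
qed

lemma open_map_stone_cech:
  assumes f: "continuous_map (stone_cech D) (stone_cech E) f"
    and \<eta>: "\<And>d. d \<in> D \<Longrightarrow> \<eta> d \<in> E \<and> f (principal {d}) = principal {\<eta> d}"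
  shows "open_map (stone_cech D) (stone_cech E) f"
  unfolding open_map_def
proof (intro allI impI)
  fix W
  assume W: "openin (stone_cech D) W"
  have f_eq: "f u = filtermap \<eta> u" if "u \<in> ultrafilters_on D" for u
    by (rule stone_cech_map_eq_filtermap[OF f \<eta> that])
  show "openin (stone_cech E) (f ` W)"
  proof (subst openin_subopen, rule ballI)
    fix v
    assume "v \<in> f ` W"
    then obtain u where u: "u \<in> W" "v = f u" by blast
    then have uD: "u \<in> ultrafilters_on D"
      using openin_subset[OF W] by (auto simp: topspace_stone_cech)
    obtain P where P: "P \<subseteq> D" "eventually (\<lambda>x. x \<in> P) u"
        "{u \<in> ultrafilters_on D. eventually (\<lambda>x. x \<in> P) u} \<subseteq> W"
      using stone_cech_basic_neighbourhood[OF W u(1)] by blast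
    let ?V = "{v \<in> ultrafilters_on E. eventually (\<lambda>y. y \<in> \<eta> ` P) v}"
    have "openin (stone_cech E) ?V"
      using \<eta> P(1) by (intro openin_stone_cech_basic) blast
    moreover have "f u \<in> ?V"
    proof -
      have "eventually (\<lambda>x. \<eta> x \<in> \<eta> ` P) u"
        using P(2) by (rule eventually_mono) blast
      moreover have "filtermap \<eta> u \<in> ultrafilters_on E"
        using \<eta> by (intro filtermap_in_ultrafilters_on[OF uD]) blast
      ultimately show ?thesis
        by (simp add: f_eq[OF uD] eventually_filtermap)
    qed
    moreover have "?V \<subseteq> f ` W"
    proof
      fix w
      assume w: "w \<in> ?V"
      \<comment> \<open>A section of \<open>\<eta>\<close> over \<open>\<eta> ` P\<close> lifts \<open>w\<close> to an ultrafilter containing \<open>P\<close>.\<close>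
      define \<sigma> where "\<sigma> = inv_into P \<eta>"
      have w_in: "eventually (\<lambda>y. y \<in> \<eta> ` P) w"
        using w by simp
      have P_in: "eventually (\<lambda>x. x \<in> P) (filtermap \<sigma> w)"
        unfolding eventually_filtermap using w_in
        by (rule eventually_mono) (simp add: \<sigma>_def inv_into_into)
      have "filtermap \<sigma> w \<in> ultrafilters_on D"
        using w eventually_mono[OF P_in, of "\<lambda>x. x \<in> D"] P(1)
        by (auto simp: ultrafilters_on_def eventually_filtermap filtermap_bot_iff)
      moreover have "filtermap \<eta> (filtermap \<sigma> w) = w"
      proof (rule filter_eqI)
        fix R :: "_ \<Rightarrow> bool"
        have "eventually (\<lambda>y. R (\<eta> (\<sigma> y)) = R y) w"
          using w_in by (rule eventually_mono) (simp add: \<sigma>_def f_inv_into_f)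
        then show "eventually R (filtermap \<eta> (filtermap \<sigma> w)) \<longleftrightarrow> eventually R w"
          unfolding eventually_filtermap by (rule eventually_subst)
      qed
      ultimately show "w \<in> f ` W"
        using P(3) P_in f_eq[of "filtermap \<sigma> w"] by (intro image_eqI[of _ _ "filtermap \<sigma> w"]) auto
    qed
    ultimately show "\<exists>T. openin (stone_cech E) T \<and> v \<in> T \<and> T \<subseteq> f ` W"
      using u(2) by blast
  qed
qed

text \<open>An ultrafilter mapped to \<open>principal {e}\<close> contains the \<eta>-fibre over
  \<open>e\<close>; a finite fibre forces it to be principal at one of its points.\<close>

lemma stone_cech_fibre_principal:
  assumes f: "continuous_map (stone_cech D) (stone_cech E) f"
    and \<eta>: "\<And>d. d \<in> D \<Longrightarrow> \<eta> d \<in> E \<and> f (principal {d}) = principal {\<eta> d}"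
    and fin: "finite {d \<in> D. \<eta> d = e}"
  shows "{u \<in> ultrafilters_on D. f u = principal {e}} = (\<lambda>d. principal {d}) ` {d \<in> D. \<eta> d = e}"
proof (intro equalityI subsetI)
  fix u
  assume "u \<in> {u \<in> ultrafilters_on D. f u = principal {e}}"
  then have u: "u \<in> ultrafilters_on D" "filtermap \<eta> u = principal {e}"
    using stone_cech_map_eq_filtermap[OF f \<eta>] by auto
  have "eventually (\<lambda>y. y = e) (filtermap \<eta> u)"
    by (simp add: u(2) eventually_principal)
  then have "eventually (\<lambda>x. x \<in> {d \<in> D. \<eta> d = e}) u"
    using u(1) by (simp add: eventually_filtermap eventually_conj_iff ultrafilters_on_def)
  from ultrafilter_finite_principal[OF u(1) fin this]
  show "u \<in> (\<lambda>d. principal {d}) ` {d \<in> D. \<eta> d = e}"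
    by blast
qed (use \<eta> principal_in_ultrafilters_on in auto)

section \<open>Words\<close>

lemma length_preserving_eq_map:
  assumes hom: "\<And>v w. \<lbrakk>v \<in> words B; w \<in> words B\<rbrakk> \<Longrightarrow> \<eta> (v @ w) = \<eta> v @ \<eta> w"
    and letters: "\<And>b. b \<in> B \<Longrightarrow> \<eta> [b] = [\<phi> b]"
    and "w \<in> words B"
  shows "\<eta> w = map \<phi> w"
  using \<open>w \<in> words B\<close>
proof (induction w)
  case Nil
  then show ?case by (simp add: words_def)
next
  case (Cons b w)
  show ?case
  \<comment> \<open>Words are non-empty, so the one-letter word is the true base case.\<close>
  proof (cases "w = []")
    case True
    then show ?thesis
      using Cons.prems letters by (simp add: words_def)
  next
    case False
    then have "[b] \<in> words B" "w \<in> words B"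
      using Cons.prems by (auto simp: words_def)
    then show ?thesis
      using hom[of "[b]" w] letters[of b] Cons.IH by (simp add: words_def)
  qed
qed

section \<open>Continuity and multiplicativity of the fibre map on words\<close>

theorem proposition4p2:
  fixes A :: "'a set" and B :: "'b set" and SX :: "('s, 'x) bis_struct"
    and f :: "'b list filter \<Rightarrow> 'a list filter" and g :: "'b list filter \<Rightarrow> 'x"
  assumes "finite A" and "finite B"
    and "bis SX"
    and "bis_morphism (beta_words B) (beta_words A) f"
    and "bis_morphism (beta_words B) SX g"
    and "length_preserving B A f"
  shows "bis_morphism (beta_words A) (Vietoris_bis SX)
    (Vietoris_image g \<circ> Vietoris_preimage (spc (beta_words B)) f \<circ> Vietoris_unit)"
proof -
  interpret f: bis_morphism "beta_words B" "beta_words A" f by fact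
  interpret g: bis_morphism "beta_words B" SX g by fact
  interpret V: bis "Vietoris_bis SX" by (rule bis_Vietoris_bis) fact
  have words_simps: "elts (beta_words C) = words C" "spc (beta_words C) = stone_cech (words C)"
      "emb (beta_words C) = (\<lambda>w. principal {w})" "mul (beta_words C) = (@)" for C :: "'c set"
    by (simp_all add: beta_words_def)
  let ?h = "Vietoris_image g \<circ> Vietoris_preimage (spc (beta_words B)) f \<circ> Vietoris_unit"
  have h_eq: "?h = (\<lambda>y. g ` {z \<in> topspace (spc (beta_words B)). f z = y})"
    by (auto simp: fun_eq_iff Vietoris_image_def Vietoris_preimage_def Vietoris_unit_def)
  obtain \<eta> where \<eta>: "\<And>v. v \<in> words B \<Longrightarrow> \<eta> v \<in> words A \<and> f (principal {v}) = principal {\<eta> v}"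
      and \<eta>_hom: "\<And>v w. \<lbrakk>v \<in> words B; w \<in> words B\<rbrakk> \<Longrightarrow> \<eta> (v @ w) = \<eta> v @ \<eta> w"
    using f.restricts_to_hom unfolding words_simps by blast
  obtain \<gamma> where \<gamma>: "\<And>v. v \<in> words B \<Longrightarrow> \<gamma> v \<in> elts SX \<and> g (principal {v}) = emb SX (\<gamma> v)"
      and \<gamma>_hom: "\<And>v w. \<lbrakk>v \<in> words B; w \<in> words B\<rbrakk> \<Longrightarrow> \<gamma> (v @ w) = mul SX (\<gamma> v) (\<gamma> w)"
    using g.restricts_to_hom unfolding words_simps by blast
  have f_cont: "continuous_map (stone_cech (words B)) (stone_cech (words A)) f"
    using f.continuous by (simp add: words_simps)
  have h_cont: "continuous_map (spc (beta_words A)) (Vietoris (spc SX)) ?h"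
    unfolding h_eq
  proof (rule continuous_map_Vietoris_fibres)
    show "open_map (spc (beta_words B)) (spc (beta_words A)) f"
      unfolding words_simps by (rule open_map_stone_cech[OF f_cont \<eta>])
  qed (use f.dom.Boolean f.cod.Boolean g.cod.Boolean f.continuous g.continuous in
      \<open>auto simp: Boolean_space_def\<close>)
  have "\<exists>a. \<eta> [b] = [a]" if "b \<in> B" for b
  proof -
    have "[b] \<in> words B"
      using that by (simp add: words_def)
    moreover obtain a where "f (principal {[b]}) = principal {[a]}"
      using assms(6) \<open>b \<in> B\<close> unfolding length_preserving_def words_simps by blast
    ultimately show ?thesis
      using \<eta>[of "[b]"] by auto
  qed
  then obtain \<phi> where \<phi>: "\<And>b. b \<in> B \<Longrightarrow> \<eta> [b] = [\<phi> b]"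
    by metis
  have \<eta>_map: "\<eta> v = map \<phi> v" if "v \<in> words B" for v
    by (rule length_preserving_eq_map[OF \<eta>_hom \<phi> that])
  \<comment> \<open>The fibre of \<eta> over \<open>w\<close>. It is finite because its words have
    the length of \<open>w\<close> and letters in the finite set \<open>B\<close>.\<close>
  define F where "F w = {v \<in> words B. \<eta> v = w}" for w
  have F_fin: "finite (F w)" for w
  proof (rule finite_subset)
    show "F w \<subseteq> {v. set v \<subseteq> B \<and> length v = length w}"
    proof
      fix v
      assume v: "v \<in> F w"
      then have "w = map \<phi> v"
        using \<eta>_map[of v] by (simp add: F_def)
      with v show "v \<in> {v. set v \<subseteq> B \<and> length v = length w}"
        by (auto simp: F_def words_def)
    qed
    show "finite {v. set v \<subseteq> B \<and> length v = length w}"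
      using finite_lists_length_eq[OF assms(2)] .
  qed
  have F_append: "F (s @ t) = {v1 @ v2 | v1 v2. v1 \<in> F s \<and> v2 \<in> F t}"
    if "s \<in> words A" "t \<in> words A" for s t
  proof (intro equalityI subsetI)
    fix v
    assume v: "v \<in> F (s @ t)"
    then have "map \<phi> v = s @ t"
      using \<eta>_map[of v] by (simp add: F_def)
    then obtain v1 v2 where v12: "v = v1 @ v2" "map \<phi> v1 = s" "map \<phi> v2 = t"
      by (auto simp: map_eq_append_conv)
    \<comment> \<open>Both pieces are non-empty because \<open>s\<close> and \<open>t\<close>
      are.\<close>
    then have "v1 \<in> words B" "v2 \<in> words B"
      using v that by (auto simp: F_def words_def)
    with v12 have "v1 \<in> F s" "v2 \<in> F t"
      by (simp_all add: F_def \<eta>_map)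
    with v12(1) show "v \<in> {v1 @ v2 | v1 v2. v1 \<in> F s \<and> v2 \<in> F t}"
      by blast
  next
    fix v
    assume "v \<in> {v1 @ v2 | v1 v2. v1 \<in> F s \<and> v2 \<in> F t}"
    then obtain v1 v2 where "v = v1 @ v2" "v1 \<in> F s" "v2 \<in> F t" by blast
    moreover from this have "v1 @ v2 \<in> words B"
      by (auto simp: F_def words_def)
    ultimately show "v \<in> F (s @ t)"
      by (simp add: F_def \<eta>_hom)
  qed
  have h_word: "?h (principal {w}) = emb SX ` \<gamma> ` F w" for w
  proof -
    have "?h (principal {w}) = g ` (\<lambda>v. principal {v}) ` F w"
      using stone_cech_fibre_principal[OF f_cont \<eta>, of w] F_fin[of w]
      unfolding h_eq by (simp add: words_simps topspace_stone_cech F_def)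
    then show ?thesis
      using \<gamma> by (auto simp: F_def image_image)
  qed
  show ?thesis
  proof unfold_locales
    show "continuous_map (spc (beta_words A)) (spc (Vietoris_bis SX)) ?h"
      using h_cont by (simp add: Vietoris_bis_def)
    show "\<exists>\<theta>. (\<forall>s\<in>elts (beta_words A). \<theta> s \<in> elts (Vietoris_bis SX) \<and>
              ?h (emb (beta_words A) s) = emb (Vietoris_bis SX) (\<theta> s)) \<and>
            (\<forall>s\<in>elts (beta_words A). \<forall>t\<in>elts (beta_words A).
              \<theta> (mul (beta_words A) s t) = mul (Vietoris_bis SX) (\<theta> s) (\<theta> t))"
    \<comment> \<open>The witness is read off from \<open>h_word\<close>. It is multiplicative
      because \<open>F\<close> turns concatenation into the product of sets and \<gamma> is a
      homomorphism.\<close>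
    proof (intro exI[of _ "\<lambda>w. \<gamma> ` F w"] conjI ballI)
      fix s
      show "\<gamma> ` F s \<in> elts (Vietoris_bis SX)"
        using F_fin[of s] \<gamma> by (auto simp: Vietoris_bis_def F_def)
      show "?h (emb (beta_words A) s) = emb (Vietoris_bis SX) (\<gamma> ` F s)"
        unfolding words_simps(3) h_word by (simp add: Vietoris_bis_def)
    next
      fix s t
      assume "s \<in> elts (beta_words A)" "t \<in> elts (beta_words A)"
      then have "\<gamma> ` F (mul (beta_words A) s t) = {\<gamma> (v1 @ v2) | v1 v2. v1 \<in> F s \<and> v2 \<in> F t}"
        by (auto simp: words_simps F_append)
      also have "\<dots> = {mul SX (\<gamma> v1) (\<gamma> v2) | v1 v2. v1 \<in> F s \<and> v2 \<in> F t}"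
        using \<gamma>_hom by (force simp: F_def)
      also have "\<dots> = mul (Vietoris_bis SX) (\<gamma> ` F s) (\<gamma> ` F t)"
        by (auto simp: Vietoris_bis_def)
      finally show "\<gamma> ` F (mul (beta_words A) s t) = mul (Vietoris_bis SX) (\<gamma> ` F s) (\<gamma> ` F t)" .
    qed
  qed
qed

end
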